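(* Let $m\ge 3$ be an integer with $m\ne 4$, let $n\ge 1$ be an integer, and let $M_{2mn}=\langle a,b : a^m=b^{2n}=1,\ bab^{-1}=a^{-1}\rangle$ (a metacyclic group). Then \[ \mathrm{CSCom}(M_{2mn})\cong\begin{cases}K_n\vee(K_{mn-n}\sqcup K_{mn}), & \text{if } m \text{ is odd},\\ K_{2n}\vee(2K_{mn/2}\sqcup K_{mn-2n}), & \text{if } m \text{ and } \tfrac m2 \text{ are even},\\ K_{2n}\vee(K_{mn}\sqcup K_{mn-2n}), & \text{if } m \text{ is even and } \tfrac m2 \text{ is odd}.\end{cases} \]
   Context: For a finite group $G$, the conjugacy super commuting graph $\mathrm{CSCom}(G)$ is the simple graph with vertex set $G$ in which two distinct vertices $g,h$ are adjacent if and only if either $g$ and $h$ are conjugate in $G$, or there exist $g'$ in the conjugacy class of $g$ and $h'$ in the conjugacy class of $h$ with $g'h'=h'g'$. $K_r$ is the complete graph on $r$ vertices, $\sqcup$ is disjoint union of graphs, $sK_r$ is the disjoint union of $s$ copies of $K_r$, and $\vee$ is the join of graphs (disjoint union together with all edges between the two vertex sets). *)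

theory Defs
  imports "HOL-Algebra.Algebra" "Graph_Theory.Graph_Theory"
begin

section \<open>Groups given by generators and relations\<close>

text \<open>
  A word over the type of generators is a list of letters; the letter \<open>(x, True)\<close> stands for the
  generator \<open>x\<close> and \<open>(x, False)\<close> for its formal inverse. A set \<open>R\<close> of pairs of words is a set of
  relations \<open>u = v\<close>. The presented group is the set of words modulo the least congruence that
  contains \<open>R\<close> and the free cancellations; this is the free group on the generators modulo the
  normal closure of the elements \<open>u v\<^sup>-\<^sup>1\<close>. Every element of the generator type is a generator.
\<close>

type_synonym 'g gword = "('g \<times> bool) list"

inductive word_eq :: "('g gword \<times> 'g gword) set \<Rightarrow> 'g gword \<Rightarrow> 'g gword \<Rightarrow> bool"
  for R where
  relation: "(u, v) \<in> R \<Longrightarrow> word_eq R u v"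
| cancel: "word_eq R [(x, e), (x, \<not> e)] []"
| refl: "word_eq R u u"
| sym: "word_eq R u v \<Longrightarrow> word_eq R v u"
| trans: "word_eq R u v \<Longrightarrow> word_eq R v w \<Longrightarrow> word_eq R u w"
| append: "word_eq R u u' \<Longrightarrow> word_eq R v v' \<Longrightarrow> word_eq R (u @ v) (u' @ v')"

definition word_class :: "('g gword \<times> 'g gword) set \<Rightarrow> 'g gword \<Rightarrow> 'g gword set" where
  "word_class R u = {v. word_eq R u v}"

definition presented_group :: "('g gword \<times> 'g gword) set \<Rightarrow> 'g gword set monoid" where
  "presented_group R =
    \<lparr> carrier = range (word_class R),
      monoid.mult = (\<lambda>U V. \<Union>u\<in>U. \<Union>v\<in>V. word_class R (u @ v)),
      one = word_class R [] \<rparr>"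

lemma word_class_eq_iff: "word_class R u = word_class R v \<longleftrightarrow> word_eq R u v"
proof
  assume "word_class R u = word_class R v"
  then have "v \<in> word_class R u"
    by (simp add: word_class_def word_eq.refl)
  then show "word_eq R u v"
    by (simp add: word_class_def)
next
  assume "word_eq R u v"
  then show "word_class R u = word_class R v"
    unfolding word_class_def by (blast dest: word_eq.sym word_eq.trans)
qed

lemma carrier_presented_group: "carrier (presented_group R) = range (word_class R)"
  by (simp add: presented_group_def)

lemma one_presented_group: "\<one>\<^bsub>presented_group R\<^esub> = word_class R []"
  by (simp add: presented_group_def)

lemma mult_presented_group:
  "word_class R u \<otimes>\<^bsub>presented_group R\<^esub> word_class R v = word_class R (u @ v)"
proof -
  have "word_class R (u' @ v') = word_class R (u @ v)"
    if "u' \<in> word_class R u" "v' \<in> word_class R v" for u' v'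
    using that unfolding word_class_eq_iff
    by (intro word_eq.append) (simp_all add: word_class_def word_eq.sym)
  moreover have "u \<in> word_class R u" "v \<in> word_class R v"
    by (simp_all add: word_class_def word_eq.refl)
  ultimately have "(\<Union>u'\<in>word_class R u. \<Union>v'\<in>word_class R v. word_class R (u' @ v'))
      = word_class R (u @ v)"
    by blast
  then show ?thesis
    by (simp add: presented_group_def)
qed

lemma word_eq_left_inverse: "\<exists>v. word_eq R (v @ u) []"
proof (induction u)
  case Nil
  show ?case by (rule exI[of _ "[]"]) (simp add: word_eq.refl)
next
  case (Cons a u)
  then obtain v where v: "word_eq R (v @ u) []" by blast
  obtain x e where a: "a = (x, e)" by fastforce
  have "word_eq R [(x, \<not> e), (x, e)] []"
    using word_eq.cancel[of R x "\<not> e"] by simp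
  then have "word_eq R (v @ [(x, \<not> e), (x, e)] @ u) (v @ [] @ u)"
    by (intro word_eq.append word_eq.refl)
  then have "word_eq R ((v @ [(x, \<not> e)]) @ a # u) (v @ u)"
    by (simp add: a)
  then have "word_eq R ((v @ [(x, \<not> e)]) @ a # u) []"
    using v by (rule word_eq.trans)
  then show ?case by blast
qed

lemma group_presented_group: "group (presented_group R)"
proof (rule groupI)
  fix U assume "U \<in> carrier (presented_group R)"
  then obtain u where u: "U = word_class R u" by (auto simp: carrier_presented_group)
  obtain v where "word_eq R (v @ u) []" using word_eq_left_inverse by blast
  then show "\<exists>V \<in> carrier (presented_group R). V \<otimes>\<^bsub>presented_group R\<^esub> U = \<one>\<^bsub>presented_group R\<^esub>"
    by (intro bexI[of _ "word_class R v"])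
      (auto simp: u carrier_presented_group mult_presented_group one_presented_group word_class_eq_iff)
qed (auto simp: carrier_presented_group mult_presented_group one_presented_group)

definition word_eval :: "('h, 'i) monoid_scheme \<Rightarrow> ('g \<Rightarrow> 'h) \<Rightarrow> 'g gword \<Rightarrow> 'h" where
  "word_eval H f w =
    foldr (\<lambda>(x, e) y. (if e then f x else inv\<^bsub>H\<^esub> f x) \<otimes>\<^bsub>H\<^esub> y) w \<one>\<^bsub>H\<^esub>"

lemma presented_group_universal:
  assumes "group H" and f: "\<And>x. f x \<in> carrier H"
    and R: "\<And>u v. (u, v) \<in> R \<Longrightarrow> word_eval H f u = word_eval H f v"
  obtains h where "h \<in> hom (presented_group R) H" "\<And>u. h (word_class R u) = word_eval H f u"
proof -
  interpret group H by fact
  have closed: "word_eval H f u \<in> carrier H" for u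
    by (induction u) (auto simp: word_eval_def f)
  have app: "word_eval H f (u @ v) = word_eval H f u \<otimes>\<^bsub>H\<^esub> word_eval H f v" for u v
  proof (induction u)
    case Nil
    then show ?case using closed[of v] by (simp add: word_eval_def)
  next
    case (Cons a u)
    then show ?case using closed[of u] closed[of v]
      by (cases a) (auto simp: word_eval_def f m_assoc)
  qed
  have resp: "word_eval H f u = word_eval H f v" if "word_eq R u v" for u v
    using that
  proof induction
    case (cancel x e)
    then show ?case by (cases e) (auto simp: word_eval_def f)
  qed (auto simp: R app)
  define h where "h U = word_eval H f (SOME u. U = word_class R u)" for U
  have h: "h (word_class R u) = word_eval H f u" for u
  proof -
    have "word_class R u = word_class R (SOME v. word_class R u = word_class R v)"
      by (rule someI[of "\<lambda>v. word_class R u = word_class R v"]) simp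
    then show ?thesis unfolding h_def word_class_eq_iff by (metis resp)
  qed
  have "h \<in> hom (presented_group R) H"
    by (auto simp: hom_def carrier_presented_group mult_presented_group h app closed)
  with h that show thesis by blast
qed

section \<open>The metacyclic group of order \<open>2mn\<close>\<close>

datatype two_gens = gen_a | gen_b

text \<open>The relations \<open>a\<^sup>m = 1\<close>, \<open>b\<^sup>2\<^sup>n = 1\<close> and \<open>b a b\<^sup>-\<^sup>1 = a\<^sup>-\<^sup>1\<close>.\<close>

definition metacyclic_relations :: "nat \<Rightarrow> nat \<Rightarrow> (two_gens gword \<times> two_gens gword) set" where
  "metacyclic_relations m n =
    { (replicate m (gen_a, True), []),
      (replicate (2 * n) (gen_b, True), []),
      ([(gen_b, True), (gen_a, True), (gen_b, False)], [(gen_a, False)]) }"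

definition metacyclic_group :: "nat \<Rightarrow> nat \<Rightarrow> two_gens gword set monoid" where
  "metacyclic_group m n = presented_group (metacyclic_relations m n)"

section \<open>Conjugacy super commuting graph\<close>

definition conjugacy_class :: "('a, 'b) monoid_scheme \<Rightarrow> 'a \<Rightarrow> 'a set" where
  "conjugacy_class G g =
    Group_Action.orbit G (\<lambda>x. \<lambda>y \<in> carrier G. x \<otimes>\<^bsub>G\<^esub> y \<otimes>\<^bsub>G\<^esub> inv\<^bsub>G\<^esub> x) g"

text \<open>
  A simple graph is a \<^locale>\<open>pair_graph\<close>: its edges are stored as a symmetric and irreflexive set
  of ordered pairs.
\<close>

definition CSCom :: "('a, 'b) monoid_scheme \<Rightarrow> 'a pair_pre_digraph" where
  "CSCom G =
    \<lparr> pverts = carrier G,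
      parcs = {(g, h). g \<in> carrier G \<and> h \<in> carrier G \<and> g \<noteq> h \<and>
        (h \<in> conjugacy_class G g \<or>
         (\<exists>g' \<in> conjugacy_class G g. \<exists>h' \<in> conjugacy_class G h.
            g' \<otimes>\<^bsub>G\<^esub> h' = h' \<otimes>\<^bsub>G\<^esub> g'))} \<rparr>"

section \<open>Graph operations\<close>

definition complete_graph :: "nat \<Rightarrow> nat pair_pre_digraph" where
  "complete_graph r =
    \<lparr> pverts = {..<r}, parcs = {(u, v). u \<in> {..<r} \<and> v \<in> {..<r} \<and> u \<noteq> v} \<rparr>"

definition disjoint_union ::
  "'a pair_pre_digraph \<Rightarrow> 'b pair_pre_digraph \<Rightarrow> ('a + 'b) pair_pre_digraph" where
  "disjoint_union G H =
    \<lparr> pverts = pverts G <+> pverts H,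
      parcs = map_prod Inl Inl ` parcs G \<union> map_prod Inr Inr ` parcs H \<rparr>"

definition copies :: "nat \<Rightarrow> 'a pair_pre_digraph \<Rightarrow> (nat \<times> 'a) pair_pre_digraph" where
  "copies s G =
    \<lparr> pverts = {..<s} \<times> pverts G,
      parcs = {((i, u), (i, v)) | i u v. i < s \<and> (u, v) \<in> parcs G} \<rparr>"

definition graph_join ::
  "'a pair_pre_digraph \<Rightarrow> 'b pair_pre_digraph \<Rightarrow> ('a + 'b) pair_pre_digraph" where
  "graph_join G H =
    \<lparr> pverts = pverts (disjoint_union G H),
      parcs = parcs (disjoint_union G H) \<union>
        (Inl ` pverts G) \<times> (Inr ` pverts H) \<union> (Inr ` pverts H) \<times> (Inl ` pverts G) \<rparr>"

lemma complete_digraph_complete_graph: "complete_digraph r (with_proj (complete_graph r))"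
  unfolding complete_digraph_pair_def by (auto simp: complete_graph_def)

end

theory Submission
  imports Defs
begin

text \<open>
  The relation \<open>b a b\<^sup>-\<^sup>1 = a\<^sup>-\<^sup>1\<close> moves every \<open>b\<close> to the right, so each element of the group is
  \<open>a\<^sup>i b\<^sup>j\<close> with \<open>0 \<le> i < m\<close> and \<open>0 \<le> j < 2n\<close>. That no two of these coincide is seen by mapping to
  an explicit group on pairs \<open>(i, j)\<close> in which \<open>j\<close> acts on the first coordinate by the sign
  \<open>(-1)\<^sup>j\<close> (\<open>metacyclic_group_iso_model\<close>). Adjacency is invariant under isomorphism, so only the
  group of pairs has to be studied.

  There \<open>(i, j)\<close> with \<open>j\<close> even is conjugate only to \<open>(\<plusminus>i, j)\<close>, and \<open>(i, j)\<close> with \<open>j\<close> odd exactly to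
  the \<open>(i + 2s, j)\<close>. Two elements with even second coordinate commute. Elements \<open>(i, j)\<close> with \<open>j\<close>
  even and \<open>(k, l)\<close> with \<open>l\<close> odd commute iff \<open>m\<close> divides \<open>2i\<close>, that is, iff \<open>(i, j)\<close> is central, and
  passing to conjugates does not change this. Two elements with odd second coordinates commute iff
  \<open>m\<close> divides \<open>2(i - k)\<close>; after replacing both by conjugates the condition becomes
  \<open>2(i - k) \<equiv> 4s (mod m)\<close> for some \<open>s\<close>. That is always solvable unless \<open>4\<close> divides \<open>m\<close>, and
  then it says that \<open>i - k\<close> is even (\<open>super_commuting_model_iff\<close>, \<open>four_multiple_offset_iff\<close>).

  Hence the vertices split into the centre \<open>Z\<close>, joined to everything; the set \<open>B\<close> of noncentral
  elements with even \<open>j\<close>, a clique; and the set \<open>C\<close> of elements with odd \<open>j\<close>, with no edge to \<open>B\<close>.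
  The set \<open>C\<close> is a clique if \<open>4\<close> does not divide \<open>m\<close>; otherwise it consists of two disjoint cliques
  of equal size, according to the parity of \<open>i\<close>. The congruence \<open>2i \<equiv> 0 (mod m)\<close> has one solution
  for odd \<open>m\<close> and two for even \<open>m\<close>, which gives the sizes of the cliques.
\<close>

section \<open>Graphs recognised up to isomorphism by their pieces\<close>

text \<open>
  Restricting one fixed relation \<open>E\<close> to varying vertex sets \<open>V\<close> makes it possible to recognise a graph
  piece by piece, without forming induced subgraphs.
\<close>

definition realizes :: "'a set \<Rightarrow> ('a \<Rightarrow> 'a \<Rightarrow> bool) \<Rightarrow> 'b pair_pre_digraph \<Rightarrow> bool" where
  "realizes V E H \<longleftrightarrow>
    (\<exists>f. bij_betw f V (pverts H) \<and> (\<forall>u\<in>V. \<forall>v\<in>V. E u v \<longleftrightarrow> (f u, f v) \<in> parcs H))"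

lemma realizes_imp_digraph_iso:
  assumes G: "parcs G \<subseteq> pverts G \<times> pverts G" and H: "parcs H \<subseteq> pverts H \<times> pverts H"
    and r: "realizes (pverts G) (\<lambda>u v. (u, v) \<in> parcs G) H"
  shows "digraph_iso (with_proj G) (with_proj H)"
proof -
  obtain f where f: "bij_betw f (pverts G) (pverts H)"
    and E: "\<And>u v. u \<in> pverts G \<Longrightarrow> v \<in> pverts G \<Longrightarrow> (u, v) \<in> parcs G \<longleftrightarrow> (f u, f v) \<in> parcs H"
    using r unfolding realizes_def by blast
  define h where "h = \<lparr> iso_verts = f, iso_arcs = map_prod f f, iso_head = snd, iso_tail = fst \<rparr>"
  have inj: "inj_on f (pverts G)" and im: "f ` pverts G = pverts H"
    using f by (auto simp: bij_betw_def)
  have inj2: "inj_on (map_prod f f) (parcs G)"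
    using map_prod_inj_on[OF inj inj] G by (rule inj_on_subset)
  have arcs: "map_prod f f ` parcs G = parcs H"
  proof
    show "map_prod f f ` parcs G \<subseteq> parcs H" using G E by auto
    show "parcs H \<subseteq> map_prod f f ` parcs G"
    proof
      fix e assume e: "e \<in> parcs H"
      then obtain u v where uv: "u \<in> pverts G" "v \<in> pverts G" "e = (f u, f v)"
        using H im by blast
      then have "(u, v) \<in> parcs G" using E e by simp
      then show "e \<in> map_prod f f ` parcs G" using uv by force
    qed
  qed
  have wf: "wf_digraph (with_proj G)"
    by unfold_locales (use G in auto)
  have "pre_digraph.digraph_isomorphism (with_proj G) h"
    unfolding pre_digraph.digraph_isomorphism_def using wf inj inj2 by (auto simp: h_def)
  moreover have "with_proj H = app_iso h (with_proj G)"
    by (simp add: h_def app_iso_def with_proj_def im arcs)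
  ultimately show ?thesis unfolding digraph_iso_def by blast
qed

lemma realizes_pullback:
  assumes "bij_betw \<phi> W V" and "realizes V E H"
    and "\<And>u v. u \<in> W \<Longrightarrow> v \<in> W \<Longrightarrow> E' u v \<longleftrightarrow> E (\<phi> u) (\<phi> v)"
  shows "realizes W E' H"
proof -
  obtain f where f: "bij_betw f V (pverts H)"
    and E: "\<forall>u\<in>V. \<forall>v\<in>V. E u v \<longleftrightarrow> (f u, f v) \<in> parcs H"
    using assms(2) unfolding realizes_def by blast
  have "bij_betw (f \<circ> \<phi>) W (pverts H)" using assms(1) f by (rule bij_betw_trans)
  moreover have "\<phi> u \<in> V" if "u \<in> W" for u using that assms(1) by (auto simp: bij_betw_def)
  ultimately show ?thesis unfolding realizes_def using E assms(3)
    by (intro exI[of _ "f \<circ> \<phi>"]) simp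
qed

lemma realizes_complete_graph:
  assumes "finite V" "card V = r" "\<And>u v. u \<in> V \<Longrightarrow> v \<in> V \<Longrightarrow> E u v \<longleftrightarrow> u \<noteq> v"
  shows "realizes V E (complete_graph r)"
proof -
  obtain f where f: "bij_betw f V {..<r}"
    using assms ex_bij_betw_finite_nat[of V] by (auto simp: atLeast0LessThan)
  then show ?thesis unfolding realizes_def complete_graph_def
    using assms(3) by (intro exI[of _ f]) (auto simp: bij_betw_def inj_on_def)
qed

lemma bij_betw_case_Inl_Inr:
  assumes "bij_betw f A S" "bij_betw g B T" "A \<inter> B = {}"
  shows "bij_betw (\<lambda>x. if x \<in> A then Inl (f x) else Inr (g x)) (A \<union> B) (Inl ` S \<union> Inr ` T)"
  using assms unfolding bij_betw_def inj_on_def by (auto simp: image_iff)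

lemma disjoint_union_arcs_iff [simp]:
  "(Inl u, Inl v) \<in> parcs (disjoint_union G H) \<longleftrightarrow> (u, v) \<in> parcs G"
  "(Inr x, Inr y) \<in> parcs (disjoint_union G H) \<longleftrightarrow> (x, y) \<in> parcs H"
  "(Inl u, Inr y) \<notin> parcs (disjoint_union G H)"
  "(Inr x, Inl v) \<notin> parcs (disjoint_union G H)"
  by (force simp: disjoint_union_def)+

lemma realizes_sum:
  assumes "realizes A E G" "realizes B E H" "A \<inter> B = {}"
  obtains f where "bij_betw f (A \<union> B) (pverts (disjoint_union G H))"
    "\<And>u v. u \<in> A \<Longrightarrow> v \<in> A \<Longrightarrow> E u v \<longleftrightarrow> (f u, f v) \<in> parcs (disjoint_union G H)"
    "\<And>u v. u \<in> B \<Longrightarrow> v \<in> B \<Longrightarrow> E u v \<longleftrightarrow> (f u, f v) \<in> parcs (disjoint_union G H)"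
    "f ` A = Inl ` pverts G" "f ` B = Inr ` pverts H"
proof -
  obtain f g where f: "bij_betw f A (pverts G)" "bij_betw g B (pverts H)"
    "\<forall>u\<in>A. \<forall>v\<in>A. E u v \<longleftrightarrow> (f u, f v) \<in> parcs G"
    "\<forall>u\<in>B. \<forall>v\<in>B. E u v \<longleftrightarrow> (g u, g v) \<in> parcs H"
    using assms unfolding realizes_def by blast
  show ?thesis
  proof (rule that[of "\<lambda>x. if x \<in> A then Inl (f x) else Inr (g x)"])
    show "bij_betw (\<lambda>x. if x \<in> A then Inl (f x) else Inr (g x)) (A \<union> B) (pverts (disjoint_union G H))"
      using bij_betw_case_Inl_Inr[OF f(1,2) assms(3)] by (simp add: disjoint_union_def Plus_def)
    have "v \<notin> A" if "v \<in> B" for v using that assms(3) by blast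
    then show "(\<lambda>x. if x \<in> A then Inl (f x) else Inr (g x)) ` B = Inr ` pverts H"
      using f(2) by (force simp: bij_betw_def image_iff)
  qed (use f assms(3) in \<open>auto simp: bij_betw_def\<close>)
qed

lemma realizes_disjoint_union:
  assumes "realizes A E G" "realizes B E H" "A \<inter> B = {}" "V = A \<union> B"
    and "\<And>u v. u \<in> A \<Longrightarrow> v \<in> B \<Longrightarrow> \<not> E u v \<and> \<not> E v u"
  shows "realizes V E (disjoint_union G H)"
proof -
  obtain f where f: "bij_betw f (A \<union> B) (pverts (disjoint_union G H))"
    "\<And>u v. u \<in> A \<Longrightarrow> v \<in> A \<Longrightarrow> E u v \<longleftrightarrow> (f u, f v) \<in> parcs (disjoint_union G H)"
    "\<And>u v. u \<in> B \<Longrightarrow> v \<in> B \<Longrightarrow> E u v \<longleftrightarrow> (f u, f v) \<in> parcs (disjoint_union G H)"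
    "f ` A = Inl ` pverts G" "f ` B = Inr ` pverts H"
    using realizes_sum[OF assms(1-3)] by blast
  have cross: "(f u, f v) \<notin> parcs (disjoint_union G H)" "(f v, f u) \<notin> parcs (disjoint_union G H)"
    if "u \<in> A" "v \<in> B" for u v
  proof -
    have "f u \<in> Inl ` pverts G" "f v \<in> Inr ` pverts H" using that f(4,5) by blast+
    then show "(f u, f v) \<notin> parcs (disjoint_union G H)" "(f v, f u) \<notin> parcs (disjoint_union G H)"
      by (auto simp: disjoint_union_def)
  qed
  show ?thesis unfolding realizes_def
  proof (intro exI[of _ f] conjI ballI)
    show "bij_betw f V (pverts (disjoint_union G H))"
      using f(1) assms(4) by simp
  next
    fix u v assume "u \<in> V" "v \<in> V"
    then show "E u v \<longleftrightarrow> (f u, f v) \<in> parcs (disjoint_union G H)"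
      using assms(4,5) f(2,3) cross by blast
  qed
qed

lemma realizes_graph_join:
  assumes "realizes A E G" "realizes B E H" "A \<inter> B = {}" "V = A \<union> B"
    and "\<And>u v. u \<in> A \<Longrightarrow> v \<in> B \<Longrightarrow> E u v \<and> E v u"
  shows "realizes V E (graph_join G H)"
proof -
  obtain f where f: "bij_betw f (A \<union> B) (pverts (disjoint_union G H))"
    "\<And>u v. u \<in> A \<Longrightarrow> v \<in> A \<Longrightarrow> E u v \<longleftrightarrow> (f u, f v) \<in> parcs (disjoint_union G H)"
    "\<And>u v. u \<in> B \<Longrightarrow> v \<in> B \<Longrightarrow> E u v \<longleftrightarrow> (f u, f v) \<in> parcs (disjoint_union G H)"
    "f ` A = Inl ` pverts G" "f ` B = Inr ` pverts H"
    using realizes_sum[OF assms(1-3)] by blast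
  have J: "parcs (graph_join G H) = parcs (disjoint_union G H) \<union> (f ` A) \<times> (f ` B) \<union> (f ` B) \<times> (f ` A)"
    by (simp add: graph_join_def f(4,5))
  have sep: "f ` A \<inter> f ` B = {}" unfolding f(4,5) by blast
  show ?thesis unfolding realizes_def
  proof (intro exI[of _ f] conjI ballI)
    show "bij_betw f V (pverts (graph_join G H))"
      using f(1) assms(4) by (simp add: graph_join_def disjoint_union_def)
  next
    fix u v assume "u \<in> V" "v \<in> V"
    then show "E u v \<longleftrightarrow> (f u, f v) \<in> parcs (graph_join G H)"
      unfolding J using assms(4,5) f(2,3) sep by blast
  qed
qed

text \<open>
  Two copies of a graph are its disjoint union with itself, with the tags \<open>Inl\<close> and \<open>Inr\<close> replaced by
  the indices 0 and 1.
\<close>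

lemma realizes_two_copies:
  assumes "realizes A E G" "realizes B E G" "A \<inter> B = {}" "V = A \<union> B"
    and "\<And>u v. u \<in> A \<Longrightarrow> v \<in> B \<Longrightarrow> \<not> E u v \<and> \<not> E v u"
  shows "realizes V E (copies 2 G)"
proof -
  obtain f where f: "bij_betw f V (pverts (disjoint_union G G))"
    "\<And>u v. u \<in> V \<Longrightarrow> v \<in> V \<Longrightarrow> E u v \<longleftrightarrow> (f u, f v) \<in> parcs (disjoint_union G G)"
    using realizes_disjoint_union[OF assms] unfolding realizes_def by blast
  define g :: "'b + 'b \<Rightarrow> nat \<times> 'b" where "g = case_sum (Pair 0) (Pair 1)"
  have less_2: "i < 2 \<longleftrightarrow> i = 0 \<or> i = 1" for i :: nat by auto
  have g: "bij_betw g (pverts (disjoint_union G G)) (pverts (copies 2 G))"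
    by (rule bij_betw_byWitness[where f' = "\<lambda>(i, x). if i = 0 then Inl x else Inr x"])
      (auto simp: g_def disjoint_union_def copies_def less_2)
  have "(g x, g y) \<in> parcs (copies 2 G) \<longleftrightarrow> (x, y) \<in> parcs (disjoint_union G G)" for x y
    by (cases x; cases y) (auto simp: g_def copies_def disjoint_union_def less_2)
  then show ?thesis unfolding realizes_def
    using bij_betw_trans[OF f(1) g] f(2) by (intro exI[of _ "g \<circ> f"]) simp
qed

lemma complete_graph_arcs_subset:
  "parcs (complete_graph r) \<subseteq> pverts (complete_graph r) \<times> pverts (complete_graph r)"
  by (auto simp: complete_graph_def)

lemma disjoint_union_arcs_subset:
  assumes "parcs G \<subseteq> pverts G \<times> pverts G" "parcs H \<subseteq> pverts H \<times> pverts H"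
  shows "parcs (disjoint_union G H) \<subseteq> pverts (disjoint_union G H) \<times> pverts (disjoint_union G H)"
  using assms by (auto simp: disjoint_union_def)

lemma graph_join_arcs_subset:
  assumes "parcs G \<subseteq> pverts G \<times> pverts G" "parcs H \<subseteq> pverts H \<times> pverts H"
  shows "parcs (graph_join G H) \<subseteq> pverts (graph_join G H) \<times> pverts (graph_join G H)"
  using disjoint_union_arcs_subset[OF assms] by (auto simp: graph_join_def disjoint_union_def)

lemma copies_arcs_subset:
  assumes "parcs G \<subseteq> pverts G \<times> pverts G"
  shows "parcs (copies s G) \<subseteq> pverts (copies s G) \<times> pverts (copies s G)"
  using assms by (auto simp: copies_def)

lemmas arcs_subset_intros = complete_graph_arcs_subset disjoint_union_arcs_subset
  graph_join_arcs_subset copies_arcs_subset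

section \<open>The adjacency relation without inverses\<close>

text \<open>
  Conjugacy \<open>h = x g x\<^sup>-\<^sup>1\<close> is written as \<open>h x = x g\<close>. The relation then mentions only the
  multiplication, so it transfers along isomorphisms directly and can be computed in a concrete group
  without knowing its inverses.
\<close>

definition super_commuting :: "('a, 'b) monoid_scheme \<Rightarrow> 'a \<Rightarrow> 'a \<Rightarrow> bool" where
  "super_commuting G g h \<longleftrightarrow>
    (\<exists>x\<in>carrier G. h \<otimes>\<^bsub>G\<^esub> x = x \<otimes>\<^bsub>G\<^esub> g) \<or>
    (\<exists>x\<in>carrier G. \<exists>y\<in>carrier G. \<exists>g'\<in>carrier G. \<exists>h'\<in>carrier G.
      g' \<otimes>\<^bsub>G\<^esub> x = x \<otimes>\<^bsub>G\<^esub> g \<and> h' \<otimes>\<^bsub>G\<^esub> y = y \<otimes>\<^bsub>G\<^esub> h \<and> g' \<otimes>\<^bsub>G\<^esub> h' = h' \<otimes>\<^bsub>G\<^esub> g')"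

lemma (in group) conjugacy_class_iff:
  assumes g: "g \<in> carrier G"
  shows "h \<in> conjugacy_class G g \<longleftrightarrow> h \<in> carrier G \<and> (\<exists>x\<in>carrier G. h \<otimes> x = x \<otimes> g)"
proof -
  have "h = x \<otimes> g \<otimes> inv x \<longleftrightarrow> h \<in> carrier G \<and> h \<otimes> x = x \<otimes> g" if "x \<in> carrier G" for x
    using that g inv_solve_right[of h "x \<otimes> g" x] by auto
  then show ?thesis
    unfolding conjugacy_class_def Group_Action.orbit_def using g by auto
qed

lemma (in group) CSCom_arcs_iff:
  assumes "g \<in> carrier G" "h \<in> carrier G"
  shows "(g, h) \<in> parcs (CSCom G) \<longleftrightarrow> g \<noteq> h \<and> super_commuting G g h"
  using assms unfolding CSCom_def super_commuting_def
  by (simp add: conjugacy_class_iff Bex_def) blast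

lemma (in group) super_commuting_iso:
  assumes \<phi>: "\<phi> \<in> iso G H" and gh: "g \<in> carrier G" "h \<in> carrier G"
  shows "super_commuting G g h \<longleftrightarrow> super_commuting H (\<phi> g) (\<phi> h)"
proof -
  have im: "carrier H = \<phi> ` carrier G" and inj: "inj_on \<phi> (carrier G)" and
    mult: "\<And>x y. x \<in> carrier G \<Longrightarrow> y \<in> carrier G \<Longrightarrow> \<phi> (x \<otimes> y) = \<phi> x \<otimes>\<^bsub>H\<^esub> \<phi> y"
    using \<phi> by (auto simp: iso_def hom_def bij_betw_def)
  have eq: "\<phi> w \<otimes>\<^bsub>H\<^esub> \<phi> x = \<phi> y \<otimes>\<^bsub>H\<^esub> \<phi> z \<longleftrightarrow> w \<otimes> x = y \<otimes> z"
    if "w \<in> carrier G" "x \<in> carrier G" "y \<in> carrier G" "z \<in> carrier G" for w x y z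
    using that inj_on_eq_iff[OF inj, of "w \<otimes> x" "y \<otimes> z"] by (simp add: mult)
  show ?thesis
    unfolding super_commuting_def im using gh by (simp add: eq cong: bex_cong)
qed

section \<open>The group of pairs of exponents\<close>

text \<open>
  The semidirect product of the integers modulo \<open>m\<close> and modulo \<open>2n\<close>, where \<open>j\<close> acts by \<open>(-1)\<^sup>j\<close>;
  the pair \<open>(i, j)\<close> stands for \<open>a\<^sup>i b\<^sup>j\<close>.
\<close>

definition metacyclic_model :: "nat \<Rightarrow> nat \<Rightarrow> (int \<times> int) monoid" where
  "metacyclic_model m n =
    \<lparr> carrier = {0..<int m} \<times> {0..<2 * int n},
      monoid.mult = (\<lambda>(i, j) (k, l).
        ((i + (if even j then k else - k)) mod int m, (j + l) mod (2 * int n))),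
      one = (0, 0) \<rparr>"

lemma metacyclic_model_simps:
  "carrier (metacyclic_model m n) = {0..<int m} \<times> {0..<2 * int n}"
  "(i, j) \<otimes>\<^bsub>metacyclic_model m n\<^esub> (k, l) =
    ((i + (if even j then k else - k)) mod int m, (j + l) mod (2 * int n))"
  "\<one>\<^bsub>metacyclic_model m n\<^esub> = (0, 0)"
  by (simp_all add: metacyclic_model_def)

text \<open>
  The sign \<open>(-1)\<^sup>j\<close> survives reduction of \<open>j\<close> because the modulus \<open>2n\<close> is even. The simplifier
  produces either order of the factors.
\<close>

lemma even_mod_double [simp]:
  fixes x y :: int
  shows "even (x mod (2 * y)) \<longleftrightarrow> even x" "even (x mod (y * 2)) \<longleftrightarrow> even x"
  by (simp_all add: dvd_mod_iff)

lemma group_metacyclic_model: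
  assumes "m \<ge> 1" "n \<ge> 1"
  shows "group (metacyclic_model m n)"
proof (rule groupI)
  fix x y z assume "x \<in> carrier (metacyclic_model m n)" "y \<in> carrier (metacyclic_model m n)"
    "z \<in> carrier (metacyclic_model m n)"
  obtain i j k l p q where xyz: "x = (i, j)" "y = (k, l)" "z = (p, q)"
    by (metis surj_pair)
  show "x \<otimes>\<^bsub>metacyclic_model m n\<^esub> y \<otimes>\<^bsub>metacyclic_model m n\<^esub> z =
      x \<otimes>\<^bsub>metacyclic_model m n\<^esub> (y \<otimes>\<^bsub>metacyclic_model m n\<^esub> z)"
    unfolding xyz metacyclic_model_simps
    by (cases "even j"; cases "even l")
      (simp_all add: mod_simps algebra_simps)
next
  fix x assume "x \<in> carrier (metacyclic_model m n)"
  then obtain i j where x: "x = (i, j)" "0 \<le> i" "i < int m" "0 \<le> j" "j < 2 * int n"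
    by (auto simp: metacyclic_model_simps)
  show "\<exists>y\<in>carrier (metacyclic_model m n). y \<otimes>\<^bsub>metacyclic_model m n\<^esub> x = \<one>\<^bsub>metacyclic_model m n\<^esub>"
    by (rule bexI[of _ "((if even j then - i else i) mod int m, (- j) mod (2 * int n))"])
      (use assms in \<open>auto simp: x(1) metacyclic_model_simps mod_simps\<close>)
qed (use assms in \<open>auto simp: metacyclic_model_simps\<close>)

text \<open>
  Conjugating \<open>(i, j)\<close> by \<open>(p, q)\<close> gives \<open>(p \<plusminus> i - (-1)\<^sup>j p, j)\<close>, where the sign of \<open>i\<close> is \<open>(-1)\<^sup>q\<close>. For even \<open>j\<close>
  the two contributions of \<open>p\<close> cancel, leaving \<open>\<plusminus>i\<close>. For odd \<open>j\<close> they add up to \<open>2p\<close>, and the choice of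
  the sign is absorbed by \<open>-i = i - 2i\<close>.
\<close>

lemma conjugate_in_model_iff:
  assumes n: "n \<ge> 1" and ij: "(i, j) \<in> carrier (metacyclic_model m n)"
    and ij': "(i', j') \<in> carrier (metacyclic_model m n)"
  shows "(\<exists>x\<in>carrier (metacyclic_model m n).
      (i', j') \<otimes>\<^bsub>metacyclic_model m n\<^esub> x = x \<otimes>\<^bsub>metacyclic_model m n\<^esub> (i, j)) \<longleftrightarrow>
    j' = j \<and> (if even j then int m dvd i' - i \<or> int m dvd i' + i else \<exists>s. int m dvd i' - i - 2 * s)"
    (is "?L \<longleftrightarrow> ?R")
proof -
  have m: "int m > 0" using ij by (auto simp: metacyclic_model_simps)
  have conj: "(i', j') \<otimes>\<^bsub>metacyclic_model m n\<^esub> (p, q) = (p, q) \<otimes>\<^bsub>metacyclic_model m n\<^esub> (i, j) \<longleftrightarrow>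
      j' = j \<and> int m dvd i' + (if even j then p else - p) - (p + (if even q then i else - i))" for p q
  proof -
    have "(j' + q) mod (2 * int n) = (q + j) mod (2 * int n) \<longleftrightarrow> j' mod (2 * int n) = j mod (2 * int n)"
      unfolding mod_eq_dvd_iff by (simp add: algebra_simps)
    also have "\<dots> \<longleftrightarrow> j' = j" using ij ij' by (simp add: metacyclic_model_simps)
    finally show ?thesis by (auto simp: metacyclic_model_simps mod_eq_dvd_iff)
  qed
  show ?thesis
  proof
    assume ?L
    then obtain p q where "(i', j') \<otimes>\<^bsub>metacyclic_model m n\<^esub> (p, q) = (p, q) \<otimes>\<^bsub>metacyclic_model m n\<^esub> (i, j)"
      by auto
    then have j: "j' = j" and d: "int m dvd i' + (if even j then p else - p) - (p + (if even q then i else - i))"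
      by (simp_all only: conj)
    show ?R
    proof (cases "even j")
      case True
      then show ?thesis using d j by (auto split: if_splits)
    next
      case False
      have "int m dvd i' - i - 2 * (if even q then p else p - i)"
        using d False by (auto simp: algebra_simps split: if_splits)
      then show ?thesis using j False by auto
    qed
  next
    assume R: ?R
    show ?L
    proof (cases "even j")
      case True
      then consider "int m dvd i' - i" | "int m dvd i' + i" using R by auto
      then show ?thesis
      proof cases
        case 1
        then show ?thesis using R True m n
          by (intro bexI[of _ "(0, 0)"] conj[THEN iffD2]) (auto simp: metacyclic_model_simps)
      next
        case 2
        then show ?thesis using R True m n
          by (intro bexI[of _ "(0, 1)"] conj[THEN iffD2]) (auto simp: metacyclic_model_simps)
      qed
    next
      case False
      then obtain s where s: "int m dvd i' - i - 2 * s" using R by auto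
      have "int m dvd 2 * (s - s mod int m)" by (simp add: minus_mod_eq_mult_div)
      from dvd_add[OF s this] have "int m dvd i' - i - 2 * (s mod int m)"
        by (simp add: algebra_simps)
      then show ?thesis using R False m n
        by (intro bexI[of _ "(s mod int m, 0)"] conj[THEN iffD2])
          (auto simp: metacyclic_model_simps algebra_simps)
    qed
  qed
qed

lemma commute_in_model_iff:
  "(i, j) \<otimes>\<^bsub>metacyclic_model m n\<^esub> (k, l) = (k, l) \<otimes>\<^bsub>metacyclic_model m n\<^esub> (i, j) \<longleftrightarrow>
    (if even j then even l \<or> int m dvd 2 * i
     else if even l then int m dvd 2 * k else int m dvd 2 * (i - k))"
proof -
  have "int m dvd - (2 * k) \<longleftrightarrow> int m dvd 2 * k" by (rule dvd_minus_iff)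
  then show ?thesis
    by (auto simp: metacyclic_model_simps mod_eq_dvd_iff algebra_simps)
qed

text \<open>
  Conjugation multiplies the first coordinate by a sign when the second one is even, and this affects
  neither \<open>2i \<equiv> 0\<close> nor its analogue for \<open>k\<close>. When both second coordinates are odd, the conjugates
  \<open>i + 2s\<close> and \<open>k + 2t\<close> commute iff \<open>2(i - k) + 4(s - t) \<equiv> 0\<close>, so it suffices to move one of the two
  elements. If \<open>(i, j)\<close> and \<open>(k, l)\<close> are conjugate with \<open>j = l\<close> odd, then \<open>k \<equiv> i + 2s\<close> and the last
  congruence holds as well.
\<close>

lemma super_commuting_model_iff:
  assumes n: "n \<ge> 1" and ij: "(i, j) \<in> carrier (metacyclic_model m n)"
    and kl: "(k, l) \<in> carrier (metacyclic_model m n)"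
  shows "super_commuting (metacyclic_model m n) (i, j) (k, l) \<longleftrightarrow>
    (if even j then even l \<or> int m dvd 2 * i
     else if even l then int m dvd 2 * k else \<exists>s. int m dvd 2 * (i - k) + 4 * s)"
    (is "?L \<longleftrightarrow> ?R")
proof -
  \<comment> \<open>The pairs \<open>(i, j)\<close> and \<open>(i', j)\<close> are conjugate; conjugates always share the second coordinate.\<close>
  define conj where "conj i j i' \<longleftrightarrow>
    (if even j then int m dvd i' - i \<or> int m dvd i' + i else \<exists>s. int m dvd i' - i - 2 * s)"
    for i j i' :: int
  have m: "int m > 0" using ij by (auto simp: metacyclic_model_simps)
  \<comment> \<open>The conjugating elements \<open>x\<close> and \<open>y\<close> occur independently, so each conjugacy can be rewritten by
    itself.\<close>
  have bex: "(\<exists>x\<in>A. \<exists>y\<in>A. \<exists>g'\<in>A. \<exists>h'\<in>A. P g' x \<and> Q h' y \<and> S g' h') \<longleftrightarrow>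
      (\<exists>g'\<in>A. \<exists>h'\<in>A. (\<exists>x\<in>A. P g' x) \<and> (\<exists>y\<in>A. Q h' y) \<and> S g' h')" for A and P Q S :: "'x \<Rightarrow> 'x \<Rightarrow> bool"
    by blast
  have L: "?L \<longleftrightarrow> (l = j \<and> conj i j k) \<or>
    (\<exists>i'\<in>{0..<int m}. \<exists>k'\<in>{0..<int m}. conj i j i' \<and> conj k l k' \<and>
      (i', j) \<otimes>\<^bsub>metacyclic_model m n\<^esub> (k', l) = (k', l) \<otimes>\<^bsub>metacyclic_model m n\<^esub> (i', j))"
  proof -
    have "(\<exists>g'\<in>carrier (metacyclic_model m n). \<exists>h'\<in>carrier (metacyclic_model m n).
        (\<exists>x\<in>carrier (metacyclic_model m n). g' \<otimes>\<^bsub>metacyclic_model m n\<^esub> x = x \<otimes>\<^bsub>metacyclic_model m n\<^esub> (i, j)) \<and>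
        (\<exists>y\<in>carrier (metacyclic_model m n). h' \<otimes>\<^bsub>metacyclic_model m n\<^esub> y = y \<otimes>\<^bsub>metacyclic_model m n\<^esub> (k, l)) \<and>
        g' \<otimes>\<^bsub>metacyclic_model m n\<^esub> h' = h' \<otimes>\<^bsub>metacyclic_model m n\<^esub> g') \<longleftrightarrow>
      (\<exists>i'\<in>{0..<int m}. \<exists>k'\<in>{0..<int m}. conj i j i' \<and> conj k l k' \<and>
      (i', j) \<otimes>\<^bsub>metacyclic_model m n\<^esub> (k', l) = (k', l) \<otimes>\<^bsub>metacyclic_model m n\<^esub> (i', j))"
      (is "(\<exists>g'\<in>?C. \<exists>h'\<in>?C. ?P g' \<and> ?Q h' \<and> ?S g' h') \<longleftrightarrow> _")
    proof -
      have P: "?P g' \<longleftrightarrow> (\<exists>i'. g' = (i', j) \<and> conj i j i')" if "g' \<in> ?C" for g'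
        using conjugate_in_model_iff[OF n ij, of "fst g'" "snd g'"] that
        unfolding conj_def by (cases g') auto
      have Q: "?Q g' \<longleftrightarrow> (\<exists>i'. g' = (i', l) \<and> conj k l i')" if "g' \<in> ?C" for g'
        using conjugate_in_model_iff[OF n kl, of "fst g'" "snd g'"] that
        unfolding conj_def by (cases g') auto
      have C: "(x, j) \<in> ?C \<longleftrightarrow> x \<in> {0..<int m}" "(x, l) \<in> ?C \<longleftrightarrow> x \<in> {0..<int m}" for x
        using ij kl by (auto simp: metacyclic_model_simps)
      show ?thesis
      proof
        assume "\<exists>g'\<in>?C. \<exists>h'\<in>?C. ?P g' \<and> ?Q h' \<and> ?S g' h'"
        then obtain g' h' where gh: "g' \<in> ?C" "h' \<in> ?C" "?P g'" "?Q h'" "?S g' h'" by blast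
        then obtain i' k' where "g' = (i', j)" "conj i j i'" "h' = (k', l)" "conj k l k'"
          using P Q by meson
        then show "\<exists>i'\<in>{0..<int m}. \<exists>k'\<in>{0..<int m}. conj i j i' \<and> conj k l k' \<and> ?S (i', j) (k', l)"
          using gh C by blast
      next
        assume "\<exists>i'\<in>{0..<int m}. \<exists>k'\<in>{0..<int m}. conj i j i' \<and> conj k l k' \<and> ?S (i', j) (k', l)"
        then obtain i' k' where "(i', j) \<in> ?C" "(k', l) \<in> ?C" "conj i j i'" "conj k l k'" "?S (i', j) (k', l)"
          using C by blast
        then show "\<exists>g'\<in>?C. \<exists>h'\<in>?C. ?P g' \<and> ?Q h' \<and> ?S g' h'"
          using P[of "(i', j)"] Q[of "(k', l)"] by blast
      qed
    qed
    then show ?thesis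
      unfolding super_commuting_def bex
      using conjugate_in_model_iff[OF n ij kl] by (simp add: conj_def)
  qed
  have refl: "conj i j i" for i j by (auto simp: conj_def intro: exI[of _ 0])
  have ik: "i \<in> {0..<int m}" "k \<in> {0..<int m}" using ij kl by (auto simp: metacyclic_model_simps)
  \<comment> \<open>The condition \<open>2x \<equiv> 0\<close> is invariant under conjugation, since the latter only changes signs.\<close>
  have double: "int m dvd 2 * y" if hyps: "conj x z y" "even z" "int m dvd 2 * x" for x y z
  proof -
    consider "int m dvd y - x" | "int m dvd y + x" using hyps unfolding conj_def by auto
    then show ?thesis
    proof cases
      case 1
      from dvd_add[OF dvd_mult[OF 1, of 2] hyps(3)] show ?thesis by (simp add: algebra_simps)
    next
      case 2
      from dvd_diff[OF dvd_mult[OF 2, of 2] hyps(3)] show ?thesis by (simp add: algebra_simps)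
    qed
  qed
  have conj_sym: "conj x z y" if "conj y z x" "even z" for x y z
    using that unfolding conj_def by (auto simp: dvd_diff_commute add.commute)
  show ?thesis
  proof
    assume ?R
    show ?L
    proof (cases "even j \<or> even l")
      case True
      then have "(i, j) \<otimes>\<^bsub>metacyclic_model m n\<^esub> (k, l) = (k, l) \<otimes>\<^bsub>metacyclic_model m n\<^esub> (i, j)"
        using \<open>?R\<close> unfolding commute_in_model_iff by (auto split: if_splits)
      then show ?thesis unfolding L using refl ik by blast
    next
      case False
      then obtain s where s: "int m dvd 2 * (i - k) + 4 * s" using \<open>?R\<close> by auto
      \<comment> \<open>The conjugate \<open>(i + 2s, j)\<close> of \<open>(i, j)\<close> commutes with \<open>(k, l)\<close> itself.\<close>
      define i' where "i' = (i + 2 * s) mod int m"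
      have r: "int m dvd i' - (i + 2 * s)"
        unfolding i'_def by (metis dvd_diff_commute dvd_minus_mod)
      then have "conj i j i'" using False unfolding conj_def by (auto simp: algebra_simps)
      moreover have "int m dvd 2 * (i' - k)"
        using dvd_add[OF dvd_mult[OF r, of 2] s] by (simp add: algebra_simps)
      ultimately show ?thesis unfolding L commute_in_model_iff
        using False refl ik(2) m by (intro disjI2 bexI[of _ i'] bexI[of _ k]) (auto simp: i'_def)
    qed
  next
    assume ?L
    then consider (same) "l = j" "conj i j k" | (comm) i' k' where "conj i j i'" "conj k l k'"
      "(i', j) \<otimes>\<^bsub>metacyclic_model m n\<^esub> (k', l) = (k', l) \<otimes>\<^bsub>metacyclic_model m n\<^esub> (i', j)"
      unfolding L by blast
    then show ?R
    proof cases
      case same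
      show ?thesis
      proof (cases "even j")
        case False
        then obtain s where "int m dvd k - i - 2 * s" using same unfolding conj_def by auto
        then have "int m dvd (-2) * (k - i - 2 * s)" by (rule dvd_mult)
        then have "int m dvd 2 * (i - k) + 4 * s" by (simp add: algebra_simps)
        then show ?thesis using False same by auto
      qed (use same in auto)
    next
      case comm
      show ?thesis
      proof (cases "even j \<or> even l")
        case True
        then show ?thesis using comm double conj_sym unfolding commute_in_model_iff
          by (metis (full_types))
      next
        case False
        then obtain s t where st: "int m dvd i' - i - 2 * s" "int m dvd k' - k - 2 * t"
          using comm unfolding conj_def by auto
        have "int m dvd 2 * (i' - k')" using comm(3) False unfolding commute_in_model_iff by auto
        from dvd_add[OF dvd_diff[OF this dvd_mult[OF st(1), of 2]] dvd_mult[OF st(2), of 2]]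
        have "int m dvd 2 * (i - k) + 4 * (s - t)" by (simp add: algebra_simps)
        then have "\<exists>s. int m dvd 2 * (i - k) + 4 * s" by blast
        then show ?thesis using False by simp
      qed
    qed
  qed
qed

text \<open>
  The multiples of 4 modulo \<open>m\<close> are the multiples of \<open>gcd(4, m)\<close>. The witness for \<open>s\<close> is half of
  \<open>d\<close>, of \<open>d + m\<close> or of \<open>d + m/2\<close>, up to sign, whichever of these is even.
\<close>

lemma four_multiple_offset_iff:
  "(\<exists>s. int m dvd 2 * d + 4 * s) \<longleftrightarrow> even d \<or> \<not> 4 dvd m" (is "?L \<longleftrightarrow> ?R")
proof
  assume ?L
  then obtain s where s: "int m dvd 2 * d + 4 * s" by blast
  show ?R
  proof (cases "4 dvd m")
    case True
    then have "4 dvd int m" by presburger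
    then have "4 dvd 2 * d + 4 * s" using s by (rule dvd_trans)
    then have "even d" by presburger
    then show ?thesis ..
  qed simp
next
  assume ?R
  moreover have "4 dvd m" if "even m" "even (m div 2)" using that by presburger
  ultimately consider "even d" | "odd d" "odd m" | "odd d" "even m" "odd (m div 2)" by blast
  then show ?L
  proof cases
    case 1
    then obtain e where "d = 2 * e" by (rule evenE)
    then have "2 * d + 4 * (- e) = 0" by simp
    then show ?thesis by (metis dvd_0_right)
  next
    case 2
    then have "even (d + int m)" by simp
    then obtain e where "d + int m = 2 * e" by (rule evenE)
    then have "2 * d + 4 * (- e) = int m * (-2)" by simp
    then show ?thesis by (metis dvd_triv_left)
  next
    case 3
    then have "even (d + int (m div 2))" by presburger
    then obtain e where "d + int (m div 2) = 2 * e" by (rule evenE)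
    then have "2 * d + 4 * (- e) = int m * (-1)" using 3(2) by auto
    then show ?thesis by (metis dvd_triv_left)
  qed
qed

section \<open>Normal forms in the presented group\<close>

declare word_eq.trans [trans]

lemma word_eq_replicate_mod:
  assumes "word_eq R (replicate k x) []"
  shows "word_eq R (replicate i x) (replicate (i mod k) x)"
proof -
  have "word_eq R (replicate (q * k + r) x) (replicate r x)" for q r
  proof (induction q)
    case (Suc q)
    have "replicate (Suc q * k + r) x = replicate k x @ replicate (q * k + r) x"
      by (simp add: replicate_add)
    also have "word_eq R \<dots> ([] @ replicate r x)"
      using assms Suc.IH by (rule word_eq.append)
    finally show ?case by simp
  qed (simp add: word_eq.refl)
  from this[of "i div k" "i mod k"] show ?thesis by simp
qed

text \<open>
  Letters of finite order make formal inverses superfluous: every word equals a positive one.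
\<close>

lemma word_eq_inverse_letter:
  assumes "word_eq R (replicate (Suc k) (x, True)) []"
  shows "word_eq R [(x, False)] (replicate k (x, True))"
proof -
  have "word_eq R ([(x, False)] @ []) ([(x, False)] @ replicate (Suc k) (x, True))"
    by (intro word_eq.append word_eq.refl word_eq.sym[OF assms])
  also have "[(x, False)] @ replicate (Suc k) (x, True) = [(x, False), (x, \<not> False)] @ replicate k (x, True)"
    by simp
  also have "word_eq R \<dots> ([] @ replicate k (x, True))"
    by (intro word_eq.append word_eq.refl word_eq.cancel)
  finally show ?thesis by simp
qed

context
  fixes m n :: nat
  assumes m: "m \<ge> 1" and n: "n \<ge> 1"
begin

private abbreviation "R \<equiv> metacyclic_relations m n"
private abbreviation "A i \<equiv> replicate i (gen_a, True)"
private abbreviation "B j \<equiv> replicate j (gen_b, True)"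

lemma power_a: "word_eq R (A m) []" and power_b: "word_eq R (B (2 * n)) []"
  and twist: "word_eq R [(gen_b, True), (gen_a, True), (gen_b, False)] [(gen_a, False)]"
  by (rule word_eq.relation, simp add: metacyclic_relations_def)+

lemma inverse_a: "word_eq R [(gen_a, False)] (A (m - 1))"
  using m power_a by (intro word_eq_inverse_letter) simp

lemma inverse_b: "word_eq R [(gen_b, False)] (B (2 * n - 1))"
  using n power_b by (intro word_eq_inverse_letter) simp

text \<open>
  Moving \<open>b\<close> past one \<open>a\<close> turns that \<open>a\<close> into \<open>a\<^sup>-\<^sup>1 = a\<^sup>m\<^sup>-\<^sup>1\<close>.
\<close>

lemma move_b_past_a: "word_eq R ((gen_b, True) # A i) (A (i * (m - 1)) @ [(gen_b, True)])"
proof (induction i)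
  case 0
  then show ?case by (simp add: word_eq.refl)
next
  case (Suc i)
  have ba: "word_eq R [(gen_b, True), (gen_a, True)] (A (m - 1) @ [(gen_b, True)])"
  proof -
    have "word_eq R ([(gen_b, True), (gen_a, True)] @ []) ([(gen_b, True), (gen_a, True)] @ [(gen_b, False), (gen_b, \<not> False)])"
      by (intro word_eq.append word_eq.refl word_eq.sym[OF word_eq.cancel])
    also have "\<dots> = [(gen_b, True), (gen_a, True), (gen_b, False)] @ [(gen_b, True)]" by simp
    also have "word_eq R \<dots> (A (m - 1) @ [(gen_b, True)])"
      by (intro word_eq.append word_eq.refl word_eq.trans[OF twist inverse_a])
    finally show ?thesis by simp
  qed
  have "(gen_b, True) # A (Suc i) = [(gen_b, True), (gen_a, True)] @ A i" by simp
  also have "word_eq R \<dots> ((A (m - 1) @ [(gen_b, True)]) @ A i)"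
    by (intro word_eq.append word_eq.refl ba)
  also have "\<dots> = A (m - 1) @ ((gen_b, True) # A i)" by simp
  also have "word_eq R \<dots> (A (m - 1) @ A (i * (m - 1)) @ [(gen_b, True)])"
    by (intro word_eq.append word_eq.refl Suc.IH)
  also have "\<dots> = A (Suc i * (m - 1)) @ [(gen_b, True)]" by (simp add: replicate_add)
  finally show ?case .
qed

text \<open>
  Words of the form \<open>a\<^sup>i b\<^sup>j\<close> are closed, up to equality in the group, under prepending a letter: this is
  clear for a power of \<open>a\<close>, and follows from \<open>move_b_past_a\<close> for a power of \<open>b\<close>. A formal inverse is
  such a power.
\<close>

lemma normal_form_exists: "\<exists>i<m. \<exists>j<2 * n. word_eq R u (A i @ B j)"
proof -
  have b: "\<exists>i' j'. word_eq R ((gen_b, True) # A i @ B j) (A i' @ B j')" for i j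
  proof -
    have "(gen_b, True) # A i @ B j = ((gen_b, True) # A i) @ B j" by simp
    also have "word_eq R \<dots> ((A (i * (m - 1)) @ [(gen_b, True)]) @ B j)"
      by (intro word_eq.append word_eq.refl move_b_past_a)
    also have "\<dots> = A (i * (m - 1)) @ B (Suc j)" by simp
    finally show ?thesis by blast
  qed
  have bs: "\<exists>i' j'. word_eq R (B k @ A i @ B j) (A i' @ B j')" for k i j
  proof (induction k)
    case 0
    then show ?case using word_eq.refl by auto
  next
    case (Suc k)
    then obtain i' j' where ij': "word_eq R (B k @ A i @ B j) (A i' @ B j')" by blast
    obtain i'' j'' where "word_eq R ((gen_b, True) # A i' @ B j') (A i'' @ B j'')"
      using b by blast
    with word_eq.append[OF word_eq.refl[of R "[(gen_b, True)]"] ij']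
    have "word_eq R (B (Suc k) @ A i @ B j) (A i'' @ B j'')"
      by (auto dest: word_eq.trans)
    then show ?case by blast
  qed
  have "\<exists>i j. word_eq R u (A i @ B j)"
  proof (induction u)
    case Nil
    show ?case using word_eq.refl[of R "[]"] by (intro exI[of _ 0]) simp
  next
    case (Cons x u)
    then obtain i j where u: "word_eq R u (A i @ B j)" by blast
    have pre: "word_eq R (x # u) (w @ A i @ B j)" if "word_eq R [x] w" for w
      using word_eq.append[OF that u] by simp
    have "\<exists>i' j'. word_eq R (x # u) (A i' @ B j')" if "word_eq R [x] (A k)" for k
      using pre[OF that] replicate_add[of k i "(gen_a, True)"] by (metis append.assoc)
    moreover have "\<exists>i' j'. word_eq R (x # u) (A i' @ B j')" if "word_eq R [x] (B k)" for k
      using pre[OF that] bs by (blast intro: word_eq.trans)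
    moreover have "word_eq R [x] (A 1) \<or> word_eq R [x] (A (m - 1)) \<or> word_eq R [x] (B 1) \<or> word_eq R [x] (B (2 * n - 1))"
    proof (cases x)
      case (Pair c e)
      show ?thesis
        using inverse_a inverse_b word_eq.refl[of R "[x]"] unfolding Pair by (cases c; cases e) auto
    qed
    ultimately show ?case by blast
  qed
  then obtain i j where "word_eq R u (A i @ B j)" by blast
  also have "word_eq R (A i @ B j) (A (i mod m) @ B (j mod (2 * n)))"
    by (intro word_eq.append word_eq_replicate_mod power_a power_b)
  finally show ?thesis using m n
    by (intro exI[of _ "i mod m"] exI[of _ "j mod (2 * n)"] conjI) auto
qed

text \<open>
  The universal property gives a homomorphism that sends \<open>a\<^sup>i b\<^sup>j\<close> to \<open>(i, j)\<close>. Every class contains a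
  reduced normal form, and distinct reduced normal forms have distinct images, so the homomorphism is
  injective; every pair arises, so it is surjective.
\<close>

lemma metacyclic_group_iso_model: "\<exists>\<phi>. \<phi> \<in> iso (metacyclic_group m n) (metacyclic_model m n)"
proof -
  define M where "M = metacyclic_model m n"
  interpret M: group M unfolding M_def using m n by (rule group_metacyclic_model)
  \<comment> \<open>For \<open>m = 1\<close> the generator \<open>a\<close> is trivial, hence \<open>1 mod m\<close> in place of 1.\<close>
  define f where "f = (\<lambda>c. case c of gen_a \<Rightarrow> (1 mod int m, 0 :: int) | gen_b \<Rightarrow> (0, 1))"
  have f: "f c \<in> carrier M" for c
    using m n by (cases c) (auto simp: f_def M_def metacyclic_model_simps)
  have eval_b: "word_eval M f (B j) = (0, int j mod (2 * int n))" for j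
    by (induction j) (simp_all add: word_eval_def f_def M_def metacyclic_model_simps mod_simps)
  have eval: "word_eval M f (A i @ B j) = (int i mod int m, int j mod (2 * int n))" for i j
  proof (induction i)
    case 0
    then show ?case by (simp add: eval_b)
  next
    case (Suc i)
    then show ?case
      by (simp add: word_eval_def f_def M_def metacyclic_model_simps mod_simps)
  qed
  have inv_a: "inv\<^bsub>M\<^esub> f gen_a = ((- 1) mod int m, 0)"
    by (rule M.inv_equality) (use f m n in \<open>auto simp: f_def M_def metacyclic_model_simps mod_simps\<close>)
  have inv_b: "inv\<^bsub>M\<^esub> f gen_b = (0, 2 * int n - 1)"
    by (rule M.inv_equality) (use f m n in \<open>auto simp: f_def M_def metacyclic_model_simps mod_simps\<close>)
  have rel: "word_eval M f u = word_eval M f v" if "(u, v) \<in> R" for u v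
  proof -
    have "word_eval M f [] = (0, 0)" by (simp add: word_eval_def M_def metacyclic_model_simps)
    moreover have "word_eval M f (A m) = (0, 0)" "word_eval M f (B (2 * n)) = (0, 0)"
      using eval[of m 0] eval[of 0 "2 * n"] by simp_all
    moreover have "word_eval M f [(gen_b, True), (gen_a, True), (gen_b, False)] = word_eval M f [(gen_a, False)]"
      using n by (simp add: word_eval_def inv_a inv_b) (simp add: f_def M_def metacyclic_model_simps mod_simps)
    ultimately show ?thesis using that by (auto simp: metacyclic_relations_def)
  qed
  obtain h where hom: "h \<in> hom (presented_group R) M" and h: "\<And>u. h (word_class R u) = word_eval M f u"
    using presented_group_universal[OF M.is_group f rel] by blast
  have nf: "\<exists>i<m. \<exists>j<2 * n. U = word_class R (A i @ B j)" if U: "U \<in> carrier (presented_group R)" for U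
  proof -
    obtain u where u: "U = word_class R u" using U by (auto simp: carrier_presented_group)
    show ?thesis using normal_form_exists[of u] unfolding u word_class_eq_iff .
  qed
  have h_nf: "h (word_class R (A i @ B j)) = (int i, int j)" if "i < m" "j < 2 * n" for i j
    using that by (simp add: h eval)
  have "bij_betw h (carrier (presented_group R)) (carrier M)"
  proof (rule bij_betw_imageI)
    show "inj_on h (carrier (presented_group R))"
    proof (rule inj_onI)
      fix U V assume "U \<in> carrier (presented_group R)" "V \<in> carrier (presented_group R)" and eq: "h U = h V"
      then obtain i j i' j' where ij: "i < m" "j < 2 * n" "U = word_class R (A i @ B j)"
        "i' < m" "j' < 2 * n" "V = word_class R (A i' @ B j')"
        using nf[of U] nf[of V] by auto
      then show "U = V" using eq h_nf by simp
    qed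
    show "h ` carrier (presented_group R) = carrier M"
    proof
      show "h ` carrier (presented_group R) \<subseteq> carrier M" using hom by (auto simp: hom_def)
      show "carrier M \<subseteq> h ` carrier (presented_group R)"
      proof
        fix x assume "x \<in> carrier M"
        then obtain i j where x: "x = (i, j)" "0 \<le> i" "i < int m" "0 \<le> j" "j < 2 * int n"
          by (auto simp: M_def metacyclic_model_simps)
        then have "x = h (word_class R (A (nat i) @ B (nat j)))"
          by (subst h_nf) auto
        then show "x \<in> h ` carrier (presented_group R)"
          by (auto simp: carrier_presented_group)
      qed
    qed
  qed
  then have "h \<in> iso (metacyclic_group m n) (metacyclic_model m n)"
    using hom by (simp add: iso_def metacyclic_group_def M_def)
  then show ?thesis by blast
qed

end

section \<open>Counting the pieces\<close>

lemma card_even_residues: "card {j \<in> {0..<2 * int k}. even j} = k"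
  and card_odd_residues: "card {j \<in> {0..<2 * int k}. odd j} = k"
proof -
  have "{j \<in> {0..<2 * int k}. even j} = (\<lambda>i. 2 * i) ` {0..<int k}"
    by (auto elim!: evenE)
  then show "card {j \<in> {0..<2 * int k}. even j} = k"
    by (simp add: card_image inj_on_def)
  have "{j \<in> {0..<2 * int k}. odd j} = (\<lambda>i. 2 * i + 1) ` {0..<int k}"
    by (auto elim!: oddE)
  then show "card {j \<in> {0..<2 * int k}. odd j} = k"
    by (simp add: card_image inj_on_def)
qed

text \<open>
  If \<open>0 \<le> i < m\<close> then \<open>0 \<le> 2i < 2m\<close>, so \<open>m\<close> divides \<open>2i\<close> only for \<open>2i = 0\<close> and \<open>2i = m\<close>.
\<close>

lemma card_half_residues:
  assumes "m \<ge> 1"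
  shows "card {i \<in> {0..<int m}. int m dvd 2 * i} = (if even m then 2 else 1)"
proof -
  have multiple: "int m dvd 2 * i \<longleftrightarrow> i = 0 \<or> 2 * i = int m" if "0 \<le> i" "i < int m" for i
  proof
    assume "int m dvd 2 * i"
    then obtain c where c: "2 * i = int m * c" by (elim dvdE)
    have "0 \<le> int m * c" "int m * c < int m * 2" using c that by linarith+
    then have "0 \<le> c" "c < 2"
      using assms by (simp_all add: zero_le_mult_iff mult_less_cancel_left)
    then have "c = 0 \<or> c = 1" by linarith
    then show "i = 0 \<or> 2 * i = int m" using c by auto
  qed auto
  show ?thesis
  proof (cases "even m")
    case True
    then have "{i \<in> {0..<int m}. int m dvd 2 * i} = {0, int (m div 2)}"
      using assms multiple by auto
    moreover have "int (m div 2) \<noteq> 0" using True assms by presburger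
    ultimately show ?thesis using True by simp
  next
    case False
    then have "2 * i \<noteq> int m" for i by presburger
    then have "{i \<in> {0..<int m}. int m dvd 2 * i} = {0}"
      using assms multiple by auto
    then show ?thesis using False by simp
  qed
qed

theorem theorem2p9:
  fixes m n :: nat
  assumes "m \<ge> 3" and "m \<noteq> 4" and "n \<ge> 1"
  shows
    "(odd m \<longrightarrow>
        digraph_iso (with_proj (CSCom (metacyclic_group m n)))
          (with_proj (graph_join (complete_graph n)
            (disjoint_union (complete_graph (m * n - n)) (complete_graph (m * n)))))) \<and>
     (even m \<and> even (m div 2) \<longrightarrow>
        digraph_iso (with_proj (CSCom (metacyclic_group m n)))
          (with_proj (graph_join (complete_graph (2 * n))
            (disjoint_union (copies 2 (complete_graph (m * n div 2)))
              (complete_graph (m * n - 2 * n)))))) \<and>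
     (even m \<and> odd (m div 2) \<longrightarrow>
        digraph_iso (with_proj (CSCom (metacyclic_group m n)))
          (with_proj (graph_join (complete_graph (2 * n))
            (disjoint_union (complete_graph (m * n)) (complete_graph (m * n - 2 * n))))))"
proof -
  have m: "m \<ge> 1" using assms by simp
  define E where "E g h \<longleftrightarrow> g \<noteq> h \<and> super_commuting (metacyclic_model m n) g h" for g h
  let ?V = "carrier (metacyclic_model m n)"
  have reduce: "digraph_iso (with_proj (CSCom (metacyclic_group m n))) (with_proj H)"
    if "realizes ?V E H" and "parcs H \<subseteq> pverts H \<times> pverts H" for H :: "'x pair_pre_digraph"
  proof (rule realizes_imp_digraph_iso)
    interpret group "metacyclic_group m n"
      unfolding metacyclic_group_def by (rule group_presented_group)
    obtain \<phi> where \<phi>: "\<phi> \<in> iso (metacyclic_group m n) (metacyclic_model m n)"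
      using metacyclic_group_iso_model[OF m assms(3)] by blast
    then have bij: "bij_betw \<phi> (carrier (metacyclic_group m n)) ?V"
      by (simp add: iso_def)
    have V: "pverts (CSCom (metacyclic_group m n)) = carrier (metacyclic_group m n)"
      by (simp add: CSCom_def)
    show "realizes (pverts (CSCom (metacyclic_group m n)))
        (\<lambda>u v. (u, v) \<in> parcs (CSCom (metacyclic_group m n))) H"
      unfolding V
    proof (rule realizes_pullback[OF bij that(1)])
      fix u v assume uv: "u \<in> carrier (metacyclic_group m n)" "v \<in> carrier (metacyclic_group m n)"
      then show "(u, v) \<in> parcs (CSCom (metacyclic_group m n)) \<longleftrightarrow> E (\<phi> u) (\<phi> v)"
        using bij_betw_imp_inj_on[OF bij]
        by (simp add: CSCom_arcs_iff super_commuting_iso[OF \<phi>] E_def inj_on_eq_iff)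
    qed
    show "parcs (CSCom (metacyclic_group m n)) \<subseteq>
        pverts (CSCom (metacyclic_group m n)) \<times> pverts (CSCom (metacyclic_group m n))"
      by (auto simp: CSCom_def)
  qed (rule that(2))
  \<comment> \<open>\<open>I \<times> J0\<close> is the centre: \<open>(i, j)\<close> with \<open>j\<close> even commutes with the odd pairs iff \<open>m\<close> divides \<open>2i\<close>.\<close>
  define J0 J1 where "J0 = {j \<in> {0..<2 * int n}. even j}" and "J1 = {j \<in> {0..<2 * int n}. odd j}"
  define I where "I = {i \<in> {0..<int m}. int m dvd 2 * i}"
  define Z B C where "Z = I \<times> J0" and "B = ({0..<int m} - I) \<times> J0" and "C = {0..<int m} \<times> J1"
  have fin: "finite J0" "finite J1" "finite I" "I \<subseteq> {0..<int m}"
    unfolding J0_def J1_def I_def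
    by (rule finite_subset[OF Collect_restrict], simp)+ (rule Collect_restrict)
  have cardJ: "card J0 = n" "card J1 = n"
    unfolding J0_def J1_def by (rule card_even_residues card_odd_residues)+
  have cardI: "card I = (if even m then 2 else 1)"
    unfolding I_def using m by (rule card_half_residues)
  have cardB: "card B = m * n - card I * n"
    unfolding B_def card_cartesian_product using fin
    by (simp add: cardJ card_Diff_subset diff_mult_distrib)
  have cardC: "card C = m * n" unfolding C_def card_cartesian_product by (simp add: cardJ)
  have J: "J0 \<union> J1 = {0..<2 * int n}" "J0 \<inter> J1 = {}" and even: "\<And>j. j \<in> J0 \<Longrightarrow> even j"
    and odd: "\<And>j. j \<in> J1 \<Longrightarrow> odd j"
    by (auto simp: J0_def J1_def)
  have adj: "E (i, j) (k, l) \<longleftrightarrow> (i, j) \<noteq> (k, l) \<and>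
      (if even j then even l \<or> i \<in> I else if even l then k \<in> I else even (i - k) \<or> \<not> 4 dvd m)"
    if "i \<in> {0..<int m}" "k \<in> {0..<int m}" "j \<in> J0 \<union> J1" "l \<in> J0 \<union> J1" for i j k l
  proof -
    have "(i, j) \<in> ?V" "(k, l) \<in> ?V" using that J by (simp_all add: metacyclic_model_simps)
    from super_commuting_model_iff[OF assms(3) this] show ?thesis
      using that(1,2) unfolding E_def four_multiple_offset_iff by (simp add: I_def)
  qed
  have adj_even: "E (i, j) (k, l) \<longleftrightarrow> (i, j) \<noteq> (k, l)"
    if "i \<in> {0..<int m}" "k \<in> {0..<int m}" "j \<in> J0" "l \<in> J0" for i j k l
    using adj[of i k j l] that even[of j] even[of l] by simp
  have adj_mixed: "E (i, j) (k, l) \<longleftrightarrow> i \<in> I" "E (k, l) (i, j) \<longleftrightarrow> i \<in> I"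
    if "i \<in> {0..<int m}" "k \<in> {0..<int m}" "j \<in> J0" "l \<in> J1" for i j k l
    using adj[of i k j l] adj[of k i l j] that even[of j] odd[of l] by auto
  have adj_odd: "E (i, j) (k, l) \<longleftrightarrow> (i, j) \<noteq> (k, l) \<and> (even (i - k) \<or> \<not> 4 dvd m)"
    if "i \<in> {0..<int m}" "k \<in> {0..<int m}" "j \<in> J1" "l \<in> J1" for i j k l
    using adj[of i k j l] that odd[of j] odd[of l] by simp
  have V: "?V = Z \<union> (B \<union> C)"
    unfolding metacyclic_model_simps Z_def B_def C_def J(1)[symmetric] using fin(4) by blast
  have disj: "Z \<inter> (B \<union> C) = {}" "B \<inter> C = {}"
    unfolding Z_def B_def C_def using J(2) by blast+
  have Z: "realizes Z E (complete_graph (card I * n))"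
  proof (rule realizes_complete_graph)
    show "card Z = card I * n" by (simp add: Z_def card_cartesian_product cardJ)
    show "E u v \<longleftrightarrow> u \<noteq> v" if "u \<in> Z" "v \<in> Z" for u v
      using that subsetD[OF fin(4)] by (cases u; cases v) (auto simp: Z_def adj_even)
  qed (simp add: Z_def fin)
  have B: "realizes B E (complete_graph (m * n - card I * n))"
  proof (rule realizes_complete_graph)
    show "E u v \<longleftrightarrow> u \<noteq> v" if "u \<in> B" "v \<in> B" for u v
      using that by (cases u; cases v) (auto simp: B_def adj_even)
  qed (simp_all add: cardB, simp add: B_def fin)
  have BC: "\<not> E u v \<and> \<not> E v u" if "u \<in> B" "v \<in> C" for u v
    using that by (cases u; cases v) (auto simp: B_def C_def adj_mixed)
  have ZBC: "E u v \<and> E v u" if "u \<in> Z" "v \<in> B \<union> C" for u v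
  proof -
    obtain i j k l where uv: "u = (i, j)" "v = (k, l)" by (metis surj_pair)
    then have ij: "i \<in> I" "i \<in> {0..<int m}" "j \<in> J0" and k: "k \<in> {0..<int m}"
      and l: "l \<in> J1 \<or> l \<in> J0 \<and> k \<notin> I"
      using that fin(4) by (auto simp: Z_def B_def C_def)
    show ?thesis
    proof (cases "l \<in> J1")
      case True
      then show ?thesis using adj_mixed[OF ij(2) k ij(3)] ij(1) by (simp add: uv)
    next
      case False
      then show ?thesis using l ij k adj_even by (auto simp: uv)
    qed
  qed
  have C: "realizes C E (complete_graph (m * n))" if "\<not> 4 dvd m"
  proof (rule realizes_complete_graph)
    show "E u v \<longleftrightarrow> u \<noteq> v" if "u \<in> C" "v \<in> C" for u v
      using that \<open>\<not> 4 dvd m\<close> by (cases u; cases v) (auto simp: C_def adj_odd)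
  qed (simp_all add: cardC, simp add: C_def fin)
  have C2: "realizes C E (copies 2 (complete_graph (m * n div 2)))" if four: "4 dvd m"
  proof -
    obtain k where k: "m = 2 * k" using four by (metis dvd_def mult.assoc mult_2 numeral_Bit0)
    \<comment> \<open>For \<open>4\<close> dividing \<open>m\<close> the parity of \<open>i\<close> is well defined modulo \<open>m\<close> and splits \<open>C\<close> evenly.\<close>
    define C0 C1 where "C0 = {i \<in> {0..<int m}. even i} \<times> J1" and "C1 = {i \<in> {0..<int m}. odd i} \<times> J1"
    have "card C0 = m * n div 2" "card C1 = m * n div 2"
      unfolding C0_def C1_def card_cartesian_product k
      using card_even_residues[of k] card_odd_residues[of k] by (simp_all add: cardJ)
    moreover have "C = C0 \<union> C1" "C0 \<inter> C1 = {}" by (auto simp: C_def C0_def C1_def)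
    moreover have "finite C0" "finite C1"
      unfolding C0_def C1_def
      by (intro finite_cartesian_product fin(2) finite_subset[OF Collect_restrict], simp)+
    moreover have "E u v \<longleftrightarrow> u \<noteq> v" if "u \<in> C0 \<and> v \<in> C0 \<or> u \<in> C1 \<and> v \<in> C1" for u v
      using that by (cases u; cases v) (auto simp: C0_def C1_def adj_odd)
    moreover have "\<not> E u v \<and> \<not> E v u" if "u \<in> C0" "v \<in> C1" for u v
      using that four by (cases u; cases v) (auto simp: C0_def C1_def adj_odd)
    ultimately show ?thesis
      by (intro realizes_two_copies[of C0 _ _ C1] realizes_complete_graph) auto
  qed
  have CB: "B \<union> C = C \<union> B" "C \<inter> B = {}" using disj by auto
  have join: "realizes ?V E (graph_join (complete_graph (card I * n)) H)"
    if "realizes (B \<union> C) E H" for H :: "'x pair_pre_digraph"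
    using Z that disj(1) V ZBC by (rule realizes_graph_join)
  show ?thesis
  proof (intro conjI impI)
    assume "odd m"
    then have I: "card I = 1" and "\<not> 4 dvd m" using cardI by (simp, presburger)
    then have "realizes (B \<union> C) E (disjoint_union (complete_graph (m * n - card I * n)) (complete_graph (m * n)))"
      using realizes_disjoint_union[OF B C disj(2) HOL.refl BC] by blast
    from reduce[OF join[OF this]] show "digraph_iso (with_proj (CSCom (metacyclic_group m n)))
          (with_proj (graph_join (complete_graph n)
            (disjoint_union (complete_graph (m * n - n)) (complete_graph (m * n)))))"
      by (simp add: I arcs_subset_intros)
  next
    assume "even m \<and> even (m div 2)"
    then have I: "card I = 2" and "4 dvd m" using cardI by (simp, presburger)
    then have "realizes (B \<union> C) E (disjoint_union (copies 2 (complete_graph (m * n div 2)))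
        (complete_graph (m * n - card I * n)))"
      using realizes_disjoint_union[OF C2 B CB(2,1)] BC by blast
    from reduce[OF join[OF this]] show "digraph_iso (with_proj (CSCom (metacyclic_group m n)))
          (with_proj (graph_join (complete_graph (2 * n))
            (disjoint_union (copies 2 (complete_graph (m * n div 2)))
              (complete_graph (m * n - 2 * n)))))"
      by (simp add: I arcs_subset_intros)
  next
    assume "even m \<and> odd (m div 2)"
    then have I: "card I = 2" and "\<not> 4 dvd m" using cardI by (simp, presburger)
    then have "realizes (B \<union> C) E (disjoint_union (complete_graph (m * n))
        (complete_graph (m * n - card I * n)))"
      using realizes_disjoint_union[OF C B CB(2,1)] BC by blast
    from reduce[OF join[OF this]] show "digraph_iso (with_proj (CSCom (metacyclic_group m n)))
          (with_proj (graph_join (complete_graph (2 * n))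
            (disjoint_union (complete_graph (m * n)) (complete_graph (m * n - 2 * n)))))"
      by (simp add: I arcs_subset_intros)
  qed
qed

end
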